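(* Let $(X,d_X)$ and $(Y,d_Y)$ be compact metric spaces, let $\mu\in\mathcal{P}(X)$ and $\nu\in\mathcal{P}(Y)$ with $\operatorname{supp}(\mu)=X$ and $\operatorname{supp}(\nu)=Y$, let $c:X\times Y\to\mathbb{R}$ be Lipschitz continuous, and put $A=-c$. For each $\beta>0$ let $\varphi_\beta\in C(X)$, $\psi_\beta\in C(Y)$ be a pair of functions satisfying $$\int_X e^{\beta A(x,y)+\varphi_\beta(x)+\psi_\beta(y)}\,d\mu(x)=1\quad\forall y\in Y\qquad\text{and}\qquad \int_Y e^{\beta A(x,y)+\varphi_\beta(x)+\psi_\beta(y)}\,d\nu(y)=1\quad\forall x\in X,$$ and let $\pi_\beta$ be the probability on $X\times Y$ given by $d\pi_\beta=e^{\beta A+\varphi_\beta+\psi_\beta}\,d\mu\,d\nu$. Suppose that the uniform limits $\varphi=\lim_{\beta\to+\infty}\frac{\varphi_\beta}{\beta}$ and $\psi=\lim_{\beta\to+\infty}\frac{\psi_\beta}{\beta}$ and the weak* limit $\pi=\lim_{\beta\to+\infty}\pi_\beta$ exist. Then $(\pi_\beta)_{\beta>0}$ satisfies a large deviation principle with rate function $$I(x,y)=c(x,y)-\varphi(x)-\psi(y).$$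
   Context: $\mathcal{P}(Z)$ denotes the Borel probabilities on a compact metric space $Z$ and $C(Z)$ the continuous real functions on $Z$. The product $X\times Y$ carries the metric $d_X+d_Y$. For each $\beta>0$ a pair $(\varphi_\beta,\psi_\beta)$ as in the claim exists and is unique up to replacing it by $(\varphi_\beta+d_\beta,\psi_\beta-d_\beta)$ with $d_\beta\in\mathbb{R}$ a constant. Large deviation principle: a family $(\mu_\beta)_{\beta>0}$ of probabilities on a metric space $\Omega$ satisfies a large deviation principle with rate function $I$ if $I:\Omega\to[0,+\infty]$ is lower semi-continuous and (1) $\limsup_{\beta\to+\infty}\frac1\beta\log\mu_\beta(C)\le-\inf_{\omega\in C}I(\omega)$ for any closed set $C\subset\Omega$; (2) $\liminf_{\beta\to+\infty}\frac1\beta\log\mu_\beta(U)\ge-\inf_{\omega\in U}I(\omega)$ for any open set $U\subset\Omega$. (Conventions: $\log 0=-\infty$, $\inf\emptyset=+\infty$.) *)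

theory Defs
  imports "HOL-Probability.Probability"
begin

definition borel_prob :: "'a::topological_space measure \<Rightarrow> bool" where
  "borel_prob M \<longleftrightarrow> prob_space M \<and> sets M = sets borel"

definition msupport :: "'a::topological_space measure \<Rightarrow> 'a set" where
  "msupport M = {x. \<forall>U. open U \<and> x \<in> U \<longrightarrow> emeasure M U > 0}"

text \<open>
  Lipschitz continuity for the sum metric on the product. The metric of the library on the
  product type is the Euclidean combination of the two metrics; it induces the same topology,
  so all topological notions on the product below are unaffected by the choice.
\<close>

definition lipschitz_sum_metric :: "('a::metric_space \<times> 'b::metric_space \<Rightarrow> real) \<Rightarrow> bool" where
  "lipschitz_sum_metric c \<longleftrightarrow>
     (\<exists>L\<ge>0. \<forall>x y x' y'. \<bar>c (x, y) - c (x', y')\<bar> \<le> L * (dist x x' + dist y y'))"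

definition weak_star_tendsto ::
    "('i \<Rightarrow> 'a::topological_space measure) \<Rightarrow> 'a measure \<Rightarrow> 'i filter \<Rightarrow> bool" where
  "weak_star_tendsto M N F \<longleftrightarrow>
     (\<forall>f::'a \<Rightarrow> real. continuous_on UNIV f \<longrightarrow> ((\<lambda>i. integral\<^sup>L (M i) f) \<longlongrightarrow> integral\<^sup>L N f) F)"

text \<open>Logarithm with the convention \<open>log 0 = -\<infinity>\<close> (the library has \<open>ln 0 = 0\<close>).\<close>

definition elog :: "real \<Rightarrow> ereal" where
  "elog r = (if r = 0 then -\<infinity> else ereal (ln r))"

definition lower_semicontinuous :: "('a::topological_space \<Rightarrow> ereal) \<Rightarrow> bool" where
  "lower_semicontinuous I \<longleftrightarrow> (\<forall>a. open {\<omega>. a < I \<omega>})"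

text \<open>
  Infima and limits are taken in the extended reals, so the infimum over the empty set is \<open>\<infinity>\<close>.
  Only the values \<open>M \<beta>\<close> with \<open>\<beta> > 0\<close> are relevant.
\<close>

definition large_deviation_principle ::
    "(real \<Rightarrow> 'a::metric_space measure) \<Rightarrow> ('a \<Rightarrow> ereal) \<Rightarrow> bool" where
  "large_deviation_principle M I \<longleftrightarrow>
     (\<forall>\<beta>>0. borel_prob (M \<beta>)) \<and>
     (\<forall>\<omega>. 0 \<le> I \<omega>) \<and> lower_semicontinuous I \<and>
     (\<forall>C. closed C \<longrightarrow>
        Limsup at_top (\<lambda>\<beta>. ereal (1 / \<beta>) * elog (measure (M \<beta>) C)) \<le> - (INF \<omega>\<in>C. I \<omega>)) \<and>
     (\<forall>U. open U \<longrightarrow>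
        Liminf at_top (\<lambda>\<beta>. ereal (1 / \<beta>) * elog (measure (M \<beta>) U)) \<ge> - (INF \<omega>\<in>U. I \<omega>))"

end

theory Submission
  imports Defs
begin

text \<open>
  The densities are exponentials: with \<open>G\<^sub>\<beta> = \<beta> A + \<phi>\<^sub>\<beta> + \<psi>\<^sub>\<beta>\<close> the measure \<open>\<pi>\<^sub>\<beta>\<close> is
  \<open>exp G\<^sub>\<beta>\<close> times the reference probability \<open>P = \<mu> \<Otimes> \<nu>\<close>, and \<open>G\<^sub>\<beta> / \<beta>\<close> converges
  uniformly to \<open>- I\<close>. Up to a factor \<open>exp (\<plusminus> \<beta> \<epsilon>)\<close>, uniformly in the point, the density is
  therefore \<open>exp (- \<beta> I)\<close> for large \<open>\<beta>\<close>. The upper bound follows by estimating the density on a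
  set by its supremum there, \<open>P\<close> having mass one. For the lower bound at a point \<open>z\<close> of an open
  set, \<open>I\<close> is close to \<open>I z\<close> on a neighbourhood of \<open>z\<close>; full support gives this neighbourhood a
  positive \<open>P\<close>-mass \<open>k\<close>, which does not depend on \<open>\<beta>\<close> and is thus lost in
  \<open>ln k / \<beta> \<longlonglongrightarrow> 0\<close>. The same lower bound applied to the whole space, whose mass is one,
  shows \<open>I \<ge> 0\<close>. This is the content of \<open>ldp_exp_density\<close>, which holds on any metric space.

  On the product, full support of \<open>\<mu> \<Otimes> \<nu>\<close> is inherited from the factors
  (\<open>msupport_pair_measure\<close>), and integrating first in \<open>y\<close> turns the marginal equation
  into the statement that \<open>\<pi>\<^sub>\<beta>\<close> is a probability. Compactness enters through the
  \<open>\<sigma>\<close>-algebras: on a compact product the Borel \<open>\<sigma>\<close>-algebra is the product one (\<open>sets_borel_pair_compact\<close>).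
\<close>

section \<open>The Borel sigma-algebra of a product of compact metric spaces\<close>

text \<open>
  In a compact metric space an open set \<open>U\<close> is the countable union of the compact sets of points
  at distance at least \<open>1 / (n + 1)\<close> from the complement, and finitely many open rectangles inside
  \<open>U\<close> cover each of them.
\<close>

lemma open_in_pair_borel_compact:
  fixes U :: "('a::metric_space \<times> 'b::metric_space) set"
  assumes "compact (UNIV :: 'a set)" "compact (UNIV :: 'b set)" "open U"
  shows "U \<in> sets (borel \<Otimes>\<^sub>M borel)"
proof (cases "U = UNIV")
  case True
  then show ?thesis
    using sets.top[of "borel \<Otimes>\<^sub>M borel :: ('a \<times> 'b) measure"] by (simp add: space_pair_measure)
next
  case False
  have cpt: "compact (UNIV :: ('a \<times> 'b) set)"
    using compact_Times[OF assms(1,2)] by simp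
  define K where "K n = {z. 1 / real (Suc n) \<le> infdist z (- U)}" for n
  have K_cover: "\<exists>V \<in> sets (borel \<Otimes>\<^sub>M borel). K n \<subseteq> V \<and> V \<subseteq> U" for n
  proof -
    have "closed (K n)"
      unfolding K_def by (intro closed_Collect_le continuous_intros)
    then have cK: "compact (K n)"
      using compact_Int_closed[OF cpt] by fastforce
    have KU: "K n \<subseteq> U"
    proof
      fix z assume "z \<in> K n"
      then have "0 < infdist z (- U)"
        unfolding K_def by (smt (verit) mem_Collect_eq of_nat_0_less_iff zero_less_Suc divide_pos_pos)
      then show "z \<in> U"
        by (metis ComplI infdist_zero less_irrefl)
    qed
    define R where "R = {S \<times> T | S T. open S \<and> open T \<and> S \<times> T \<subseteq> U}"
    have "\<forall>B\<in>R. open B"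
      unfolding R_def by (auto intro: open_Times)
    moreover have "K n \<subseteq> \<Union> R"
    proof
      fix z assume "z \<in> K n"
      then have "z \<in> U" using KU by blast
      from open_prod_elim[OF \<open>open U\<close> this] show "z \<in> \<Union> R"
        unfolding R_def by blast
    qed
    ultimately obtain F where F: "F \<subseteq> R" "finite F" "K n \<subseteq> \<Union> F"
      using compactE[OF cK] by metis
    have "\<Union> F \<in> sets (borel \<Otimes>\<^sub>M borel)"
      using F(1,2) unfolding R_def by (intro sets.finite_Union) auto
    moreover have "\<Union> F \<subseteq> U"
      using F(1) unfolding R_def by blast
    ultimately show ?thesis
      using F(3) by blast
  qed
  then obtain V where V: "\<And>n. V n \<in> sets (borel \<Otimes>\<^sub>M borel)" "\<And>n. K n \<subseteq> V n" "\<And>n. V n \<subseteq> U"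
    by metis
  have "U \<subseteq> (\<Union>n. K n)"
  proof
    fix z assume "z \<in> U"
    have "closed (- U)" "- U \<noteq> {}"
      using \<open>open U\<close> False by auto
    then have "infdist z (- U) \<noteq> 0"
      using \<open>z \<in> U\<close> in_closed_iff_infdist_zero by blast
    then have "0 < infdist z (- U)"
      using infdist_nonneg[of z "- U"] by linarith
    then obtain n where "1 / real (Suc n) < infdist z (- U)"
      using nat_approx_posE by blast
    then show "z \<in> (\<Union>n. K n)"
      unfolding K_def by (auto intro!: exI[of _ n])
  qed
  also have "\<dots> \<subseteq> (\<Union>n. V n)"
    using V(2) by (rule UN_mono[OF subset_refl])
  finally have "U = (\<Union>n. V n)"
    using V(3) by (intro equalityI UN_least)
  then show ?thesis
    using V(1) by auto
qed

lemma sets_borel_pair_compact: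
  assumes "compact (UNIV :: 'a::metric_space set)" "compact (UNIV :: 'b::metric_space set)"
  shows "sets (borel \<Otimes>\<^sub>M borel) = sets (borel :: ('a \<times> 'b) measure)"
proof
  have "fst \<in> borel_measurable (borel :: ('a \<times> 'b) measure)"
    "snd \<in> borel_measurable (borel :: ('a \<times> 'b) measure)"
    by (intro borel_measurable_continuous_onI continuous_intros)+
  then have "(\<lambda>z. (fst z, snd z)) \<in> (borel :: ('a \<times> 'b) measure) \<rightarrow>\<^sub>M borel \<Otimes>\<^sub>M borel"
    by (rule measurable_Pair)
  then have "id \<in> (borel :: ('a \<times> 'b) measure) \<rightarrow>\<^sub>M borel \<Otimes>\<^sub>M borel"
    by (simp add: id_def)
  then show "sets (borel \<Otimes>\<^sub>M borel) \<subseteq> sets (borel :: ('a \<times> 'b) measure)"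
    by (auto dest: measurable_sets)
  have "sets (borel :: ('a \<times> 'b) measure) = sigma_sets UNIV {U. open U}"
    by (simp add: borel_def)
  also have "\<dots> \<subseteq> sets (borel \<Otimes>\<^sub>M borel)"
    using open_in_pair_borel_compact[OF assms]
      sets.sigma_sets_subset[of "{U. open U}" "borel \<Otimes>\<^sub>M borel :: ('a \<times> 'b) measure"]
    by (auto simp: space_pair_measure)
  finally show "sets (borel :: ('a \<times> 'b) measure) \<subseteq> sets (borel \<Otimes>\<^sub>M borel)" .
qed

lemma borel_prob_pair_measure:
  fixes \<mu> :: "'a::metric_space measure" and \<nu> :: "'b::metric_space measure"
  assumes "compact (UNIV :: 'a set)" "compact (UNIV :: 'b set)" "borel_prob \<mu>" "borel_prob \<nu>"
  shows "borel_prob (\<mu> \<Otimes>\<^sub>M \<nu>)"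
proof -
  interpret pair_prob_space \<mu> \<nu>
    using assms(3,4) unfolding borel_prob_def
    by (simp add: pair_prob_space_def pair_sigma_finite_def prob_space_imp_sigma_finite)
  have "sets (\<mu> \<Otimes>\<^sub>M \<nu>) = sets (borel \<Otimes>\<^sub>M borel)"
    using assms(3,4) unfolding borel_prob_def by (intro sets_pair_measure_cong) auto
  then show ?thesis
    using sets_borel_pair_compact[OF assms(1,2)] P.prob_space_axioms unfolding borel_prob_def by simp
qed

lemma msupport_pair_measure:
  fixes \<mu> :: "'a::metric_space measure" and \<nu> :: "'b::metric_space measure"
  assumes "borel_prob \<mu>" "borel_prob \<nu>" "msupport \<mu> = UNIV" "msupport \<nu> = UNIV"
    and "sets (\<mu> \<Otimes>\<^sub>M \<nu>) = sets borel"
  shows "msupport (\<mu> \<Otimes>\<^sub>M \<nu>) = UNIV"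
proof -
  interpret \<nu>: prob_space \<nu>
    using assms(2) unfolding borel_prob_def by blast
  have "emeasure (\<mu> \<Otimes>\<^sub>M \<nu>) U > 0" if U: "open U" "z \<in> U" for U z
  proof -
    obtain S T where ST: "open S" "open T" "z \<in> S \<times> T" "S \<times> T \<subseteq> U"
      using U by (rule open_prod_elim)
    have "S \<in> sets \<mu>" "T \<in> sets \<nu>"
      using ST(1,2) assms(1,2) unfolding borel_prob_def by auto
    then have "emeasure (\<mu> \<Otimes>\<^sub>M \<nu>) (S \<times> T) = emeasure \<mu> S * emeasure \<nu> T"
      by (rule \<nu>.emeasure_pair_measure_Times)
    moreover have "fst z \<in> msupport \<mu>" "snd z \<in> msupport \<nu>"
      using assms(3,4) by auto
    then have "emeasure \<mu> S > 0" "emeasure \<nu> T > 0"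
      using ST(1-3) unfolding msupport_def by (auto simp: mem_Times_iff)
    ultimately have "emeasure (\<mu> \<Otimes>\<^sub>M \<nu>) (S \<times> T) > 0"
      by (simp add: ennreal_zero_less_mult_iff)
    also have "emeasure (\<mu> \<Otimes>\<^sub>M \<nu>) (S \<times> T) \<le> emeasure (\<mu> \<Otimes>\<^sub>M \<nu>) U"
      using ST(4) \<open>open U\<close> assms(5) by (intro emeasure_mono) auto
    finally show ?thesis .
  qed
  then show ?thesis
    unfolding msupport_def by blast
qed

section \<open>Large deviations for exponential densities\<close>

lemma scaled_elog_le:
  assumes "\<beta> > 0" "0 \<le> p" "p \<le> exp (\<beta> * a)"
  shows "ereal (1 / \<beta>) * elog p \<le> ereal a"
proof (cases "p = 0")
  case True
  then show ?thesis using \<open>\<beta> > 0\<close> by (simp add: elog_def)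
next
  case False
  then have "ln p \<le> \<beta> * a"
    using assms(2,3) ln_mono[of p "exp (\<beta> * a)"] by simp
  then have "ln p / \<beta> \<le> a"
    using \<open>\<beta> > 0\<close> by (simp add: pos_divide_le_eq mult.commute)
  then show ?thesis
    using False by (simp add: elog_def)
qed

lemma scaled_elog_ge:
  assumes "\<beta> > 0" "k > 0" "k * exp (\<beta> * a) \<le> p"
  shows "ereal (ln k / \<beta> + a) \<le> ereal (1 / \<beta>) * elog p"
proof -
  have "0 < k * exp (\<beta> * a)"
    using \<open>k > 0\<close> by simp
  then have "p > 0" and "ln (k * exp (\<beta> * a)) \<le> ln p"
    using assms(3) by auto
  moreover have "ln (k * exp (\<beta> * a)) = ln k + \<beta> * a"
    using \<open>k > 0\<close> by (simp add: ln_mult)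
  ultimately have "(ln k + \<beta> * a) / \<beta> \<le> ln p / \<beta>"
    using \<open>\<beta> > 0\<close> by (simp add: divide_right_mono)
  then have "ln k / \<beta> + a \<le> ln p / \<beta>"
    using \<open>\<beta> > 0\<close> by (simp add: add_divide_distrib)
  then show ?thesis
    using \<open>p > 0\<close> by (simp add: elog_def)
qed

lemma measure_exp_density_le:
  assumes "prob_space P" "G \<in> borel_measurable P" "S \<in> sets P" "\<And>z. z \<in> S \<Longrightarrow> G z \<le> a"
  shows "measure (density P (\<lambda>z. ennreal (exp (G z)))) S \<le> exp a"
proof -
  interpret prob_space P by fact
  have "emeasure (density P (\<lambda>z. ennreal (exp (G z)))) S
      = (\<integral>\<^sup>+z. ennreal (exp (G z)) * indicator S z \<partial>P)"
    using assms(2,3) by (intro emeasure_density) auto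
  also have "\<dots> \<le> (\<integral>\<^sup>+z. ennreal (exp a) \<partial>P)"
    using assms(4) by (intro nn_integral_mono) (auto simp: indicator_def intro!: ennreal_leI)
  also have "\<dots> = ennreal (exp a)"
    by (simp add: emeasure_space_1)
  finally show ?thesis
    by (simp add: measure_def enn2real_leI)
qed

lemma measure_exp_density_ge:
  assumes "prob_space P" "prob_space (density P (\<lambda>z. ennreal (exp (G z))))"
    and "G \<in> borel_measurable P" "S \<in> sets P" "\<And>z. z \<in> S \<Longrightarrow> a \<le> G z"
  shows "measure P S * exp a \<le> measure (density P (\<lambda>z. ennreal (exp (G z)))) S"
proof -
  interpret prob_space P by fact
  interpret D: prob_space "density P (\<lambda>z. ennreal (exp (G z)))" by fact
  have "ennreal (measure P S * exp a) = (\<integral>\<^sup>+z. ennreal (exp a) * indicator S z \<partial>P)"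
    using assms(4)
    by (simp add: nn_integral_cmult_indicator emeasure_eq_measure ennreal_mult mult.commute)
  also have "\<dots> \<le> (\<integral>\<^sup>+z. ennreal (exp (G z)) * indicator S z \<partial>P)"
    using assms(5) by (intro nn_integral_mono) (auto simp: indicator_def intro!: ennreal_leI)
  also have "\<dots> = emeasure (density P (\<lambda>z. ennreal (exp (G z)))) S"
    using assms(3,4) by (intro emeasure_density[symmetric]) auto
  finally show ?thesis
    by (simp add: D.emeasure_eq_measure)
qed

text \<open>
  Near \<open>z\<close> the density is at least \<open>exp (\<beta> (- I z - \<epsilon>))\<close> for large \<open>\<beta>\<close>, and the mass of the
  neighbourhood on which this holds contributes only \<open>O(1 / \<beta>)\<close> to the scaled logarithm.
\<close>

lemma exp_density_lower_bound:
  fixes P :: "'a::metric_space measure" and G :: "real \<Rightarrow> 'a \<Rightarrow> real" and I :: "'a \<Rightarrow> real"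
  assumes P: "borel_prob P" "msupport P = UNIV"
    and G: "\<And>\<beta>. \<beta> > 0 \<Longrightarrow> continuous_on UNIV (G \<beta>)"
    and M: "\<And>\<beta>. \<beta> > 0 \<Longrightarrow> M \<beta> = density P (\<lambda>z. ennreal (exp (G \<beta> z)))"
      "\<And>\<beta>. \<beta> > 0 \<Longrightarrow> prob_space (M \<beta>)"
    and lim: "uniform_limit UNIV (\<lambda>\<beta> z. G \<beta> z / \<beta>) (\<lambda>z. - I z) at_top"
    and I: "continuous_on UNIV I" and U: "open U" "z \<in> U"
  shows "- ereal (I z) \<le> Liminf at_top (\<lambda>\<beta>. ereal (1 / \<beta>) * elog (measure (M \<beta>) U))"
proof (rule ereal_le_epsilon2)
  fix e :: real assume "e > 0"
  interpret prob_space P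
    using P(1) unfolding borel_prob_def by blast
  \<comment> \<open>The error is split in three: the variation of \<open>I\<close> on \<open>V\<close>, the mass of \<open>V\<close> and the
    uniform convergence.\<close>
  define V where "V = U \<inter> {w. I w < I z + e / 3}"
  have "open {w. I w < I z + e / 3}"
    using I by (intro open_Collect_less continuous_intros)
  then have V: "open V" "z \<in> V" "V \<subseteq> U"
    using U \<open>e > 0\<close> unfolding V_def by auto
  define k where "k = measure P V"
  have "z \<in> msupport P"
    using P(2) by simp
  then have "emeasure P V > 0"
    using V unfolding msupport_def by blast
  then have "k > 0"
    unfolding k_def by (simp add: emeasure_eq_measure)
  have "((\<lambda>\<beta>. ln k / \<beta>) \<longlongrightarrow> 0) at_top"
    by (intro tendsto_divide_0[OF tendsto_const] filterlim_at_top_imp_at_infinity filterlim_ident)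
  then have ev1: "\<forall>\<^sub>F \<beta> in at_top. - (e / 3) < ln k / \<beta>"
    using \<open>e > 0\<close> by (intro order_tendstoD) auto
  have ev2: "\<forall>\<^sub>F \<beta> in at_top. \<forall>w\<in>UNIV. dist (G \<beta> w / \<beta>) (- I w) < e / 3"
    using uniform_limitD[OF lim, of "e / 3"] \<open>e > 0\<close> by auto
  have "\<forall>\<^sub>F \<beta> in at_top. ereal (- I z - e) \<le> ereal (1 / \<beta>) * elog (measure (M \<beta>) U)"
    using ev1 ev2 eventually_gt_at_top[of 0]
  proof eventually_elim
    case (elim \<beta>)
    have sets_P: "sets P = sets borel"
      using P(1) unfolding borel_prob_def by blast
    have G_meas: "G \<beta> \<in> borel_measurable P"
      using borel_measurable_continuous_onI[OF G[OF \<open>0 < \<beta>\<close>]] measurable_cong_sets[OF sets_P refl]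
      by blast
    have "\<beta> * (- I z - 2 * e / 3) \<le> G \<beta> w" if "w \<in> V" for w
    proof -
      have "\<bar>G \<beta> w / \<beta> + I w\<bar> < e / 3" "I w < I z + e / 3"
        using elim(2) that unfolding V_def by (auto simp: dist_real_def)
      then have "- I z - 2 * e / 3 \<le> G \<beta> w / \<beta>"
        by linarith
      then show ?thesis
        using \<open>0 < \<beta>\<close> by (simp add: field_simps)
    qed
    then have "k * exp (\<beta> * (- I z - 2 * e / 3)) \<le> measure (M \<beta>) V"
      unfolding k_def M(1)[OF \<open>0 < \<beta>\<close>]
      using M[OF \<open>0 < \<beta>\<close>] V(1) sets_P G_meas prob_space_axioms
      by (intro measure_exp_density_ge) auto
    also have "\<dots> \<le> measure (M \<beta>) U"
    proof -
      interpret M: prob_space "M \<beta>" using M(2) \<open>0 < \<beta>\<close> .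
      show ?thesis
        using V(3) U(1) sets_P M(1)[OF \<open>0 < \<beta>\<close>] by (intro M.finite_measure_mono) auto
    qed
    finally have "ereal (ln k / \<beta> + (- I z - 2 * e / 3)) \<le> ereal (1 / \<beta>) * elog (measure (M \<beta>) U)"
      using \<open>0 < \<beta>\<close> \<open>k > 0\<close> by (intro scaled_elog_ge)
    moreover have "ereal (- I z - e) \<le> ereal (ln k / \<beta> + (- I z - 2 * e / 3))"
      using elim(1) by simp
    ultimately show ?case
      by (rule order_trans[rotated])
  qed
  then have "ereal (- I z - e) \<le> Liminf at_top (\<lambda>\<beta>. ereal (1 / \<beta>) * elog (measure (M \<beta>) U))"
    by (rule Liminf_bounded)
  then have "ereal (- I z - e) + ereal e
      \<le> Liminf at_top (\<lambda>\<beta>. ereal (1 / \<beta>) * elog (measure (M \<beta>) U)) + ereal e"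
    by (rule add_right_mono)
  then show "- ereal (I z) \<le> Liminf at_top (\<lambda>\<beta>. ereal (1 / \<beta>) * elog (measure (M \<beta>) U)) + ereal e"
    by simp
qed

lemma exp_density_upper_bound:
  fixes P :: "'a::metric_space measure" and G :: "real \<Rightarrow> 'a \<Rightarrow> real" and I :: "'a \<Rightarrow> real"
  assumes P: "borel_prob P"
    and G: "\<And>\<beta>. \<beta> > 0 \<Longrightarrow> continuous_on UNIV (G \<beta>)"
    and M: "\<And>\<beta>. \<beta> > 0 \<Longrightarrow> M \<beta> = density P (\<lambda>z. ennreal (exp (G \<beta> z)))"
    and lim: "uniform_limit UNIV (\<lambda>\<beta> z. G \<beta> z / \<beta>) (\<lambda>z. - I z) at_top"
    and C: "C \<in> sets borel" "\<And>z. z \<in> C \<Longrightarrow> r \<le> I z"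
  shows "Limsup at_top (\<lambda>\<beta>. ereal (1 / \<beta>) * elog (measure (M \<beta>) C)) \<le> - ereal r"
proof (rule ereal_le_epsilon2)
  fix e :: real assume "e > 0"
  have ev: "\<forall>\<^sub>F \<beta> in at_top. \<forall>w\<in>UNIV. dist (G \<beta> w / \<beta>) (- I w) < e"
    using uniform_limitD[OF lim \<open>e > 0\<close>] .
  have "\<forall>\<^sub>F \<beta> in at_top. ereal (1 / \<beta>) * elog (measure (M \<beta>) C) \<le> ereal (- r + e)"
    using ev eventually_gt_at_top[of 0]
  proof eventually_elim
    case (elim \<beta>)
    have P': "prob_space P" "sets P = sets borel"
      using P unfolding borel_prob_def by auto
    have G_meas: "G \<beta> \<in> borel_measurable P"
      using borel_measurable_continuous_onI[OF G[OF \<open>0 < \<beta>\<close>]] measurable_cong_sets[OF P'(2) refl]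
      by blast
    have "G \<beta> w \<le> \<beta> * (- r + e)" if "w \<in> C" for w
    proof -
      have "\<bar>G \<beta> w / \<beta> + I w\<bar> < e" "r \<le> I w"
        using elim(1) C(2) that by (auto simp: dist_real_def)
      then have "G \<beta> w / \<beta> \<le> - r + e"
        by linarith
      then show ?thesis
        using \<open>0 < \<beta>\<close> by (simp add: field_simps)
    qed
    then have "measure (M \<beta>) C \<le> exp (\<beta> * (- r + e))"
      unfolding M[OF \<open>0 < \<beta>\<close>] using P' C(1) G_meas by (intro measure_exp_density_le) auto
    then show ?case
      using \<open>0 < \<beta>\<close> by (intro scaled_elog_le) auto
  qed
  then show "Limsup at_top (\<lambda>\<beta>. ereal (1 / \<beta>) * elog (measure (M \<beta>) C)) \<le> - ereal r + ereal e"
    using Limsup_bounded by fastforce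
qed

text \<open>
  Continuity of \<open>I\<close> comes from the uniform limit. Its nonnegativity is the lower bound for the
  whole space, where the scaled logarithm of the mass is identically zero.
\<close>

theorem ldp_exp_density:
  fixes P :: "'a::metric_space measure" and G :: "real \<Rightarrow> 'a \<Rightarrow> real" and I :: "'a \<Rightarrow> real"
  assumes P: "borel_prob P" "msupport P = UNIV"
    and G: "\<And>\<beta>. \<beta> > 0 \<Longrightarrow> continuous_on UNIV (G \<beta>)"
    and M: "\<And>\<beta>. \<beta> > 0 \<Longrightarrow> M \<beta> = density P (\<lambda>z. ennreal (exp (G \<beta> z)))"
      "\<And>\<beta>. \<beta> > 0 \<Longrightarrow> prob_space (M \<beta>)"
    and lim: "uniform_limit UNIV (\<lambda>\<beta> z. G \<beta> z / \<beta>) (\<lambda>z. - I z) at_top"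
  shows "large_deviation_principle M (\<lambda>z. ereal (I z))"
proof -
  have "\<forall>\<^sub>F \<beta> in at_top. continuous_on UNIV (\<lambda>z. G \<beta> z / \<beta>)"
    using eventually_gt_at_top[of "0::real"]
    by eventually_elim (use G in \<open>auto intro!: continuous_intros\<close>)
  then have "continuous_on UNIV (\<lambda>z. - I z)"
    using lim by (rule uniform_limit_theorem) simp
  then have "continuous_on UNIV (\<lambda>z. - (- I z))"
    by (rule continuous_on_minus)
  then have I_cont: "continuous_on UNIV I"
    by simp
  have sets_P: "sets P = sets borel"
    using P(1) unfolding borel_prob_def by blast
  have borel_M: "borel_prob (M \<beta>)" if "\<beta> > 0" for \<beta>
    using M[OF that] sets_P unfolding borel_prob_def by simp
  have lower: "- ereal (I z) \<le> Liminf at_top (\<lambda>\<beta>. ereal (1 / \<beta>) * elog (measure (M \<beta>) U))"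
    if "open U" "z \<in> U" for U z
    using exp_density_lower_bound[OF P G M lim I_cont that] .
  have nonneg: "0 \<le> I z" for z
  proof -
    have "\<forall>\<^sub>F \<beta> in at_top. ereal (1 / \<beta>) * elog (measure (M \<beta>) UNIV) = 0"
      using eventually_gt_at_top[of "0::real"]
    proof eventually_elim
      case (elim \<beta>)
      have "space (M \<beta>) = UNIV"
        using sets_eq_imp_space_eq[of "M \<beta>" borel] borel_M[OF elim] by (simp add: borel_prob_def)
      then have "measure (M \<beta>) UNIV = 1"
        using prob_space.prob_space[OF M(2)[OF elim]] by simp
      then show ?case
        by (simp add: elog_def)
    qed
    then have "Liminf at_top (\<lambda>\<beta>. ereal (1 / \<beta>) * elog (measure (M \<beta>) UNIV))
        = Liminf at_top (\<lambda>\<beta>::real. 0)"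
      by (rule Liminf_eq)
    also have "\<dots> = 0"
      by (simp add: Liminf_const)
    finally show ?thesis
      using lower[of UNIV z] by simp
  qed
  have lsc: "lower_semicontinuous (\<lambda>z. ereal (I z))"
    unfolding lower_semicontinuous_def
  proof
    fix a :: ereal
    show "open {\<omega>. a < ereal (I \<omega>)}"
      using I_cont by (intro open_Collect_less continuous_intros continuous_on_ereal)
  qed
  have upper: "Limsup at_top (\<lambda>\<beta>. ereal (1 / \<beta>) * elog (measure (M \<beta>) C))
      \<le> - (INF \<omega>\<in>C. ereal (I \<omega>))" if "closed C" for C
  proof (cases "C = {}")
    case True
    have "\<forall>\<^sub>F \<beta> in at_top. ereal (1 / \<beta>) * elog (measure (M \<beta>) C) \<le> - \<infinity>"
      using eventually_gt_at_top[of "0::real"] by eventually_elim (simp add: True elog_def)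
    from Limsup_bounded[OF this] show ?thesis
      unfolding True by (simp add: top_ereal_def)
  next
    case False
    \<comment> \<open>Nonnegativity of \<open>I\<close> makes the infimum finite, so it can serve as a real lower bound.\<close>
    then obtain z where "z \<in> C" by blast
    have "(INF \<omega>\<in>C. ereal (I \<omega>)) \<le> ereal (I z)"
      using \<open>z \<in> C\<close> by (rule INF_lower)
    moreover have "0 \<le> (INF \<omega>\<in>C. ereal (I \<omega>))"
      using nonneg by (intro INF_greatest) simp
    ultimately obtain r where r: "(INF \<omega>\<in>C. ereal (I \<omega>)) = ereal r"
      by (cases "INF \<omega>\<in>C. ereal (I \<omega>)") auto
    have "r \<le> I w" if "w \<in> C" for w
      using INF_lower[OF that, of "\<lambda>\<omega>. ereal (I \<omega>)"] r by simp
    then show ?thesis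
      unfolding r using \<open>closed C\<close> by (intro exp_density_upper_bound[OF P(1) G M(1) lim]) auto
  qed
  have "- (INF \<omega>\<in>U. ereal (I \<omega>)) \<le> Liminf at_top (\<lambda>\<beta>. ereal (1 / \<beta>) * elog (measure (M \<beta>) U))"
    if "open U" for U
  proof -
    have "- Liminf at_top (\<lambda>\<beta>. ereal (1 / \<beta>) * elog (measure (M \<beta>) U)) \<le> (INF \<omega>\<in>U. ereal (I \<omega>))"
      using lower[OF that] by (intro INF_greatest) (simp add: ereal_uminus_le_reorder)
    then show ?thesis
      by (simp add: ereal_uminus_le_reorder)
  qed
  then show ?thesis
    unfolding large_deviation_principle_def using borel_M nonneg lsc upper by auto
qed

section \<open>The entropic optimal transport plans\<close>

lemma nn_integral_of_integral_eq_1: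
  assumes "(\<integral>x. f x \<partial>M) = (1::real)" "\<And>x. 0 \<le> f x"
  shows "(\<integral>\<^sup>+x. ennreal (f x) \<partial>M) = 1"
proof -
  have "integrable M f"
    using assms(1) not_integrable_integral_eq by fastforce
  then show ?thesis
    using assms by (simp add: nn_integral_eq_integral)
qed

text \<open>Tonelli, as the marginal equation makes every inner integral equal to one.\<close>

lemma prob_space_density_pair_marginal:
  fixes f :: "'a \<times> 'b \<Rightarrow> real"
  assumes "prob_space \<mu>" "prob_space \<nu>" "f \<in> borel_measurable (\<mu> \<Otimes>\<^sub>M \<nu>)"
    and "\<And>z. 0 \<le> f z" "\<And>x. (\<integral>y. f (x, y) \<partial>\<nu>) = 1"
  shows "prob_space (density (\<mu> \<Otimes>\<^sub>M \<nu>) (\<lambda>z. ennreal (f z)))"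
proof
  interpret \<mu>: prob_space \<mu> by fact
  interpret \<nu>: prob_space \<nu> by fact
  have "emeasure (density (\<mu> \<Otimes>\<^sub>M \<nu>) (\<lambda>z. ennreal (f z))) (space (\<mu> \<Otimes>\<^sub>M \<nu>))
      = (\<integral>\<^sup>+z. ennreal (f z) \<partial>(\<mu> \<Otimes>\<^sub>M \<nu>))"
    using assms(3) by (simp add: emeasure_density nn_integral_set_ennreal cong: nn_integral_cong)
  also have "\<dots> = (\<integral>\<^sup>+x. \<integral>\<^sup>+y. ennreal (f (x, y)) \<partial>\<nu> \<partial>\<mu>)"
    using assms(3) by (intro \<nu>.nn_integral_fst[symmetric]) auto
  also have "\<dots> = 1"
    using nn_integral_of_integral_eq_1[OF assms(5)] assms(4) by (simp add: \<mu>.emeasure_space_1)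
  finally show "emeasure (density (\<mu> \<Otimes>\<^sub>M \<nu>) (\<lambda>z. ennreal (f z)))
      (space (density (\<mu> \<Otimes>\<^sub>M \<nu>) (\<lambda>z. ennreal (f z)))) = 1"
    by simp
qed

lemma lipschitz_sum_metric_continuous:
  assumes "lipschitz_sum_metric c"
  shows "continuous_on UNIV c"
proof -
  obtain L where L: "L \<ge> 0" "\<And>x y x' y'. \<bar>c (x, y) - c (x', y')\<bar> \<le> L * (dist x x' + dist y y')"
    using assms unfolding lipschitz_sum_metric_def by blast
  have "dist (c z) (c w) \<le> (2 * L) * dist z w" for z w
  proof -
    have "dist (c z) (c w) \<le> L * (dist (fst z) (fst w) + dist (snd z) (snd w))"
      using L(2)[of "fst z" "snd z" "fst w" "snd w"] by (simp add: dist_real_def)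
    also have "\<dots> \<le> L * (2 * dist z w)"
      using dist_fst_le[of z w] dist_snd_le[of z w] \<open>L \<ge> 0\<close> by (intro mult_left_mono) auto
    finally show ?thesis
      by simp
  qed
  then have "(2 * L)-lipschitz_on UNIV c"
    using \<open>L \<ge> 0\<close> by (intro lipschitz_onI) auto
  then show ?thesis
    by (rule lipschitz_on_continuous_on)
qed

theorem proposition1p3:
  fixes \<mu> :: "'a::metric_space measure" and \<nu> :: "'b::metric_space measure"
    and c A :: "'a \<times> 'b \<Rightarrow> real"
    and \<phi> :: "real \<Rightarrow> 'a \<Rightarrow> real" and \<psi> :: "real \<Rightarrow> 'b \<Rightarrow> real"
    and \<pi> :: "real \<Rightarrow> ('a \<times> 'b) measure"
    and \<phi>_lim :: "'a \<Rightarrow> real" and \<psi>_lim :: "'b \<Rightarrow> real" and \<pi>_lim :: "('a \<times> 'b) measure"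
  assumes "compact (UNIV :: 'a set)" and "compact (UNIV :: 'b set)"
    and "borel_prob \<mu>" and "borel_prob \<nu>"
    and "msupport \<mu> = UNIV" and "msupport \<nu> = UNIV"
    and "lipschitz_sum_metric c"
    and "A = (\<lambda>z. - c z)"
    and "\<And>\<beta>. \<beta> > 0 \<Longrightarrow> continuous_on UNIV (\<phi> \<beta>)"
    and "\<And>\<beta>. \<beta> > 0 \<Longrightarrow> continuous_on UNIV (\<psi> \<beta>)"
    and "\<And>\<beta> y. \<beta> > 0 \<Longrightarrow> (\<integral>x. exp (\<beta> * A (x, y) + \<phi> \<beta> x + \<psi> \<beta> y) \<partial>\<mu>) = 1"
    and "\<And>\<beta> x. \<beta> > 0 \<Longrightarrow> (\<integral>y. exp (\<beta> * A (x, y) + \<phi> \<beta> x + \<psi> \<beta> y) \<partial>\<nu>) = 1"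
    and "\<And>\<beta>. \<beta> > 0 \<Longrightarrow>
           \<pi> \<beta> = density (\<mu> \<Otimes>\<^sub>M \<nu>) (\<lambda>(x, y). ennreal (exp (\<beta> * A (x, y) + \<phi> \<beta> x + \<psi> \<beta> y)))"
    and "uniform_limit UNIV (\<lambda>\<beta> x. \<phi> \<beta> x / \<beta>) \<phi>_lim at_top"
    and "uniform_limit UNIV (\<lambda>\<beta> y. \<psi> \<beta> y / \<beta>) \<psi>_lim at_top"
    and "borel_prob \<pi>_lim" and "weak_star_tendsto \<pi> \<pi>_lim at_top"
  shows "large_deviation_principle \<pi> (\<lambda>(x, y). ereal (c (x, y) - \<phi>_lim x - \<psi>_lim y))"
proof -
  define G where "G \<beta> z = \<beta> * A z + \<phi> \<beta> (fst z) + \<psi> \<beta> (snd z)" for \<beta> z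
  have P: "borel_prob (\<mu> \<Otimes>\<^sub>M \<nu>)"
    using borel_prob_pair_measure assms(1-4) .
  then have sets_P: "sets (\<mu> \<Otimes>\<^sub>M \<nu>) = sets borel"
    unfolding borel_prob_def by blast
  have supp: "msupport (\<mu> \<Otimes>\<^sub>M \<nu>) = UNIV"
    using msupport_pair_measure[OF assms(3-6) sets_P] .
  have G_cont: "continuous_on UNIV (G \<beta>)" if "\<beta> > 0" for \<beta>
    unfolding G_def assms(8)
    by (intro continuous_intros lipschitz_sum_metric_continuous[OF assms(7)]
        continuous_on_compose2[OF assms(9)[OF that]] continuous_on_compose2[OF assms(10)[OF that]]) auto
  have \<pi>_eq: "\<pi> \<beta> = density (\<mu> \<Otimes>\<^sub>M \<nu>) (\<lambda>z. ennreal (exp (G \<beta> z)))" if "\<beta> > 0" for \<beta>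
    using assms(13)[OF that] by (simp add: G_def case_prod_beta')
  have "prob_space (\<pi> \<beta>)" if "\<beta> > 0" for \<beta>
  proof -
    have "G \<beta> \<in> borel_measurable (\<mu> \<Otimes>\<^sub>M \<nu>)"
      using borel_measurable_continuous_onI[OF G_cont[OF that]] measurable_cong_sets[OF sets_P refl]
      by blast
    then have "(\<lambda>z. exp (G \<beta> z)) \<in> borel_measurable (\<mu> \<Otimes>\<^sub>M \<nu>)"
      by measurable
    moreover have "(\<integral>y. exp (G \<beta> (x, y)) \<partial>\<nu>) = 1" for x
      using assms(12)[OF that] by (simp add: G_def)
    ultimately show ?thesis
      unfolding \<pi>_eq[OF that] using assms(3,4)
      by (intro prob_space_density_pair_marginal) (auto simp: borel_prob_def)
  qed
  moreover have "uniform_limit UNIV (\<lambda>\<beta> z. G \<beta> z / \<beta>)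
      (\<lambda>z. - (c z - \<phi>_lim (fst z) - \<psi>_lim (snd z))) at_top"
  proof (rule uniform_limit_cong[THEN iffD2])
    show "uniform_limit UNIV (\<lambda>\<beta> z. A z + \<phi> \<beta> (fst z) / \<beta> + \<psi> \<beta> (snd z) / \<beta>)
        (\<lambda>z. A z + \<phi>_lim (fst z) + \<psi>_lim (snd z)) at_top"
      using uniform_limit_compose'[OF assms(14), of fst UNIV] uniform_limit_compose'[OF assms(15), of snd UNIV]
      by (intro uniform_limit_intros) auto
    show "\<forall>\<^sub>F \<beta> in at_top. \<forall>z\<in>UNIV. G \<beta> z / \<beta> = A z + \<phi> \<beta> (fst z) / \<beta> + \<psi> \<beta> (snd z) / \<beta>"
      using eventually_gt_at_top[of "0::real"]
      by eventually_elim (simp add: G_def field_simps)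
  qed (simp add: assms(8))
  ultimately show ?thesis
    using ldp_exp_density[OF P supp G_cont \<pi>_eq] by (simp add: case_prod_beta')
qed

end
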